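(* Let $n\ge4$. Say that a real $n\times n$-matrix $S$ solves $( * )$ with constant $\theta\in\mathbb R$ if, for some diagonal matrix $D$, $$S=S^T,\quad S\odot\boldsymbol 1=0,\quad S\mathbf J=0,\quad S\odot S+S^2=\theta S+D. \qquad ( * )$$ (1) Suppose that the $n\times n$-matrix $S$ solves $( * )$ with some constant $\theta$ and that the off-diagonal entries of $S$ assume precisely two different values $x\neq y$. Put $z=x-y$. Then $$S=zA+y\mathbf K,$$ where $A\neq0,\mathbf K$ is the adjacency matrix of a strongly regular graph $\Gamma$. (2) Conversely, if $A\neq0,\mathbf K$ is the adjacency matrix of an $\mathrm{srg}(n,r,\lambda,\mu)$, and $y,z$ are real numbers with $z\neq0$ and $\frac yz=\frac r{1-n}$, then $S=zA+y\mathbf K$ solves $( * )$ with some constant $\theta$, and $$\hat\theta=|\lambda-\mu+1|\sqrt{\frac{n-1}{n\,r\,r^c}},\qquad\text{where } r^c=n-r-1.$$ (3) An integer $n$ occurs in this situation (that is, there is a solution $S$ of $( * )$ of size $n\times n$ whose off-diagonal entries assume precisely two different values) if and only if $n$ is either a composite number or $n=p$ is a prime with $p\equiv 1\pmod4$. In the latter case $\theta=0$.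
   Context: $\mathbf J$ is the $n\times n$ all-one matrix, $\boldsymbol1$ the identity matrix, $\mathbf K=\mathbf J-\boldsymbol1$ (the adjacency matrix of the complete graph), and $\odot$ is the Hadamard (entrywise) product. For a solution $S\neq0$ of $( * )$ with constant $\theta$, $\hat\theta=\frac{|\theta|}{\|S\|_2}$ with $\|S\|_2=\big(\sum_{i,j}S_{i,j}^2\big)^{1/2}$. Graphs are finite and simple; the adjacency matrix $A$ of a graph has $A_{u,v}=1$ if $u,v$ are adjacent and $A_{u,v}=0$ otherwise. A graph on $n$ vertices is strongly regular, and called an $\mathrm{srg}(n,r,\lambda,\mu)$, if $r,\lambda,\mu\geq0$ are integers such that every vertex has $r$ neighbors, any two adjacent vertices have exactly $\lambda$ common neighbors, and any two distinct non-adjacent vertices have exactly $\mu$ common neighbors. (Degenerate cases such as disjoint unions of complete graphs are allowed.) *)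

theory Defs
  imports
    "Jordan_Normal_Form.Matrix"
    "Graph_Theory.Pair_Digraph"
    "HOL-Number_Theory.Cong"
    "HOL-Computational_Algebra.Primes"
begin

definition all_one_mat :: "nat \<Rightarrow> real mat" where
  "all_one_mat n = mat n n (\<lambda>_. 1)"

definition complete_mat :: "nat \<Rightarrow> real mat" where
  "complete_mat n = all_one_mat n - 1\<^sub>m n"

definition hadamard :: "real mat \<Rightarrow> real mat \<Rightarrow> real mat"  (infixl "\<odot>\<^sub>m" 70) where
  "A \<odot>\<^sub>m B = mat (dim_row A) (dim_col A) (\<lambda>ij. A $$ ij * B $$ ij)"

definition solves :: "nat \<Rightarrow> real mat \<Rightarrow> real \<Rightarrow> bool" where
  "solves n S \<theta> \<longleftrightarrow>
     S \<in> carrier_mat n n \<and>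
     S = transpose_mat S \<and>
     S \<odot>\<^sub>m 1\<^sub>m n = 0\<^sub>m n n \<and>
     S * all_one_mat n = 0\<^sub>m n n \<and>
     (\<exists>D \<in> carrier_mat n n. diagonal_mat D \<and> S \<odot>\<^sub>m S + S * S = \<theta> \<cdot>\<^sub>m S + D)"

definition norm2_mat :: "real mat \<Rightarrow> real" where
  "norm2_mat S = sqrt (\<Sum>i<dim_row S. \<Sum>j<dim_col S. (S $$ (i, j))\<^sup>2)"

text \<open>Only meaningful for \<open>S \<noteq> 0\<close>.\<close>

definition theta_hat :: "real mat \<Rightarrow> real \<Rightarrow> real" where
  "theta_hat S \<theta> = \<bar>\<theta>\<bar> / norm2_mat S"

definition off_diagonal_entries :: "real mat \<Rightarrow> real set" where
  "off_diagonal_entries S = {S $$ (i, j) | i j. i < dim_row S \<and> j < dim_col S \<and> i \<noteq> j}"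

definition two_valued :: "real mat \<Rightarrow> real \<Rightarrow> real \<Rightarrow> bool" where
  "two_valued S x y \<longleftrightarrow> x \<noteq> y \<and> off_diagonal_entries S = {x, y}"

text \<open>A finite simple graph is a \<open>pair_graph\<close>, i.e. a finite loopless symmetric digraph
  without parallel arcs: each edge is represented by its two arcs.\<close>

definition neighbors :: "'a pair_pre_digraph \<Rightarrow> 'a \<Rightarrow> 'a set" where
  "neighbors G u = {v \<in> pverts G. (u, v) \<in> parcs G}"

definition srg :: "'a pair_pre_digraph \<Rightarrow> nat \<Rightarrow> nat \<Rightarrow> nat \<Rightarrow> nat \<Rightarrow> bool" where
  "srg G n r l m \<longleftrightarrow>
     pair_graph G \<and> card (pverts G) = n \<and>
     (\<forall>u \<in> pverts G. card (neighbors G u) = r) \<and>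
     (\<forall>u \<in> pverts G. \<forall>v \<in> pverts G. (u, v) \<in> parcs G \<longrightarrow>
        card (neighbors G u \<inter> neighbors G v) = l) \<and>
     (\<forall>u \<in> pverts G. \<forall>v \<in> pverts G. u \<noteq> v \<and> (u, v) \<notin> parcs G \<longrightarrow>
        card (neighbors G u \<inter> neighbors G v) = m)"

text \<open>Rows and columns are numbered from 0, so the adjacency matrix is taken of a graph with
  vertex set \<open>{0..<n}\<close>.\<close>

definition is_adjacency_mat :: "nat \<Rightarrow> nat pair_pre_digraph \<Rightarrow> real mat \<Rightarrow> bool" where
  "is_adjacency_mat n G A \<longleftrightarrow>
     pverts G = {0..<n} \<and> A = mat n n (\<lambda>(u, v). if (u, v) \<in> parcs G then 1 else 0)"

definition composite :: "nat \<Rightarrow> bool" where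
  "composite n \<longleftrightarrow> (\<exists>a b. 1 < a \<and> 1 < b \<and> n = a * b)"

end

theory Submission
  imports Defs "Jordan_Normal_Form.Schur_Decomposition" "HOL-Number_Theory.Euler_Criterion"
begin

text \<open>
  Off the diagonal, \<open>S = z A + y K\<close> with row sums 0 turns the quadratic equation into the statement
  that the entries of \<open>A\<^sup>2\<close> depend only on those of \<open>A\<close>, i.e. strong regularity; comparing
  coefficients gives \<open>\<theta> = z (\<lambda> - \<mu> + 1)\<close>.

  Composite orders are realised by disjoint unions of equal cliques, primes congruent to 1 modulo 4
  by the Legendre symbol of \<open>i - j\<close>. Conversely, let the order \<open>n\<close> be prime. Passing to the complement
  (which swaps \<open>x\<close> and \<open>y\<close>) we may assume \<open>2 r < n\<close>. The eigenvalues \<open>s \<ge> t\<close> of \<open>A\<close> on the orthogonal complement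
  of the all-one vector satisfy \<open>s + t = \<lambda> - \<mu>\<close>, \<open>s t = \<mu> - r\<close> and \<open>(r - s) (r - t) = n \<mu>\<close>. If they are
  integers and \<open>\<mu> > 0\<close>, both factors lie strictly between 0 and \<open>n\<close>, which contradicts primality; if
  \<open>\<mu> = 0\<close>, the multiplicity of \<open>s\<close> yields a factorisation of \<open>n\<close>. If they are irrational, integrality
  of the multiplicity of \<open>s\<close> forces \<open>\<mu> = \<lambda> + 1\<close> and \<open>n = 4 \<mu> + 1\<close>.
\<close>

section \<open>Traces of idempotent matrices\<close>

text \<open>Over the complex numbers the characteristic polynomial splits, so \<open>E\<close> is
  similar to an upper triangular \<open>B\<close>. Similarity preserves idempotence and trace, and a
  triangular idempotent has only 0 and 1 on its diagonal.\<close>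

lemma idempotent_trace_nat:
  fixes e :: "nat \<Rightarrow> nat \<Rightarrow> real"
  assumes idem: "\<And>i j. i < n \<Longrightarrow> j < n \<Longrightarrow> (\<Sum>k<n. e i k * e k j) = e i j"
  shows "\<exists>f::nat. (\<Sum>i<n. e i i) = real f"
proof -
  define E :: "complex mat" where "E = mat n n (\<lambda>(i, j). complex_of_real (e i j))"
  have E: "E \<in> carrier_mat n n" by (simp add: E_def)
  have EE: "E * E = E"
  proof (rule eq_matI)
    fix i j assume "i < dim_row E" "j < dim_col E"
    then have ij: "i < n" "j < n" using E by auto
    have "(E * E) $$ (i, j) = (\<Sum>k<n. complex_of_real (e i k) * complex_of_real (e k j))"
      using ij by (simp add: E_def scalar_prod_def lessThan_atLeast0)
    also have "\<dots> = complex_of_real (\<Sum>k<n. e i k * e k j)" by simp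
    also have "\<dots> = E $$ (i, j)" using ij by (simp only: idem) (simp add: E_def)
    finally show "(E * E) $$ (i, j) = E $$ (i, j)" .
  qed (use E in auto)
  obtain es where es: "char_poly E = (\<Prod>c\<leftarrow>es. [:- c, 1:])"
    using char_poly_factorized[OF E] by blast
  obtain B where B: "B \<in> carrier_mat n n" "upper_triangular B" "similar_mat E B"
    using schur_decomposition_exists[OF E es] by blast
  obtain P Q where PQ: "similar_mat_wit E B P Q" using B(3) by (auto simp: similar_mat_def)
  note w = similar_mat_witD2[OF E PQ]
  have c: "P \<in> carrier_mat n n" "Q \<in> carrier_mat n n" using w by auto
  have B_eq: "B = Q * E * P"
  proof -
    have "Q * E * P = Q * (P * B * Q) * P" using w by simp
    also have "\<dots> = (Q * P) * B * (Q * P)" using c B(1)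
      by (smt (verit) assoc_mult_mat mult_carrier_mat)
    also have "\<dots> = B" using w B(1) by simp
    finally show ?thesis by simp
  qed
  have BB: "B * B = B"
  proof -
    have "B * B = Q * E * (P * Q) * E * P" unfolding B_eq using c E
      by (smt (verit) assoc_mult_mat mult_carrier_mat)
    also have "\<dots> = Q * (E * E) * P" using w c E
      by (smt (verit) assoc_mult_mat mult_carrier_mat right_mult_one_mat)
    finally show ?thesis using EE B_eq by simp
  qed
  have b01: "B $$ (i, i) = 0 \<or> B $$ (i, i) = 1" if "i < n" for i
  proof -
    have "B $$ (i, i) = (\<Sum>k<n. B $$ (i, k) * B $$ (k, i))"
      using that B(1) by (subst BB[symmetric]) (simp add: scalar_prod_def lessThan_atLeast0)
    \<comment> \<open>For \<open>k < i\<close> the first factor lies below the diagonal of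
      \<open>B\<close>, for \<open>k > i\<close> the second one does.\<close>
    also have "\<dots> = (\<Sum>k<n. if k = i then B $$ (i, i) * B $$ (i, i) else 0)"
    proof (rule sum.cong)
      fix k assume "k \<in> {..<n}"
      then show "B $$ (i, k) * B $$ (k, i) = (if k = i then B $$ (i, i) * B $$ (i, i) else 0)"
        using B(1) that upper_triangularD[OF B(2)] by (cases k i rule: linorder_cases) auto
    qed simp
    also have "\<dots> = B $$ (i, i) * B $$ (i, i)" using that by simp
    finally show ?thesis by (metis mult_cancel_left2)
  qed
  have tr: "(\<Sum>i<n. (X * Y) $$ (i, i)) = (\<Sum>i<n. (Y * X) $$ (i, i))"
    if "X \<in> carrier_mat n n" "Y \<in> carrier_mat n n" for X Y :: "complex mat"
  proof -
    have "(\<Sum>i<n. (X * Y) $$ (i, i)) = (\<Sum>i<n. \<Sum>k<n. X $$ (i, k) * Y $$ (k, i))"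
      using that by (simp add: scalar_prod_def lessThan_atLeast0)
    also have "\<dots> = (\<Sum>k<n. \<Sum>i<n. Y $$ (k, i) * X $$ (i, k))"
      by (subst sum.swap) (simp add: mult.commute)
    also have "\<dots> = (\<Sum>i<n. (Y * X) $$ (i, i))"
      using that by (simp add: scalar_prod_def lessThan_atLeast0)
    finally show ?thesis .
  qed
  have "complex_of_real (\<Sum>i<n. e i i) = (\<Sum>i<n. E $$ (i, i))" by (simp add: E_def)
  also have "\<dots> = (\<Sum>i<n. (P * B * Q) $$ (i, i))" using w by simp
  also have "\<dots> = (\<Sum>i<n. (Q * (P * B)) $$ (i, i))" using c B(1) by (intro tr) auto
  also have "Q * (P * B) = (Q * P) * B" using c B(1) by simp
  also have "\<dots> = B" using w B(1) by simp
  also have "(\<Sum>i<n. B $$ (i, i)) = (\<Sum>i<n. if B $$ (i, i) = 1 then 1 else 0)"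
    using b01 by (intro sum.cong) auto
  also have "\<dots> = complex_of_real (real (card {i \<in> {..<n}. B $$ (i, i) = 1}))"
    by (simp flip: sum.inter_filter)
  finally show ?thesis using of_real_eq_iff by blast
qed

section \<open>Sums of Legendre symbols\<close>

text \<open>As \<open>a\<close> is invertible modulo \<open>p\<close>, the affine map permutes the
  residues, and \<open>f\<close> sees only residues.\<close>

lemma sum_affine_mod:
  fixes f :: "int \<Rightarrow> 'a::comm_monoid_add"
  assumes "p > 0" "coprime a p" and per: "\<And>x. f (x mod p) = f x"
  shows "(\<Sum>w\<in>{0..<p}. f (a * w + b)) = (\<Sum>w\<in>{0..<p}. f w)"
proof -
  have inj: "inj_on (\<lambda>w. (a * w + b) mod p) {0..<p}"
  proof (rule inj_onI)
    fix v w assume *: "v \<in> {0..<p}" "w \<in> {0..<p}" "(a * v + b) mod p = (a * w + b) mod p"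
    then have "[a * v = a * w] (mod p)" by (metis cong_add_rcancel cong_def)
    then have "[v = w] (mod p)" using assms(2) by (simp add: cong_mult_lcancel)
    then show "v = w" using * by (auto intro: cong_less_imp_eq_int)
  qed
  moreover have "(\<lambda>w. (a * w + b) mod p) ` {0..<p} = {0..<p}"
    using \<open>p > 0\<close> by (intro endo_inj_surj inj) auto
  ultimately have bij: "bij_betw (\<lambda>w. (a * w + b) mod p) {0..<p} {0..<p}"
    by (simp add: bij_betw_def)
  have "(\<Sum>w\<in>{0..<p}. f (a * w + b)) = (\<Sum>w\<in>{0..<p}. f ((a * w + b) mod p))"
    by (simp only: per)
  also have "\<dots> = (\<Sum>w\<in>{0..<p}. f w)" by (rule sum.reindex_bij_betw[OF bij])
  finally show ?thesis .
qed

lemma Legendre_values: "Legendre a p \<in> {-1, 0, 1}"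
  by (simp add: Legendre_def)

lemma Legendre_eq_0_iff: "Legendre a p = 0 \<longleftrightarrow> p dvd a"
  by (simp add: Legendre_def cong_0_iff)

lemma Legendre_mod [simp]: "Legendre (a mod p) p = Legendre a p"
  by (simp add: Legendre_def QuadRes_def cong_def)

context
  fixes p :: nat
  assumes p: "prime p" "2 < p"
begin

text \<open>Two numbers in {-1, 0, 1} differ by at most 2, which is less than \<open>p\<close>. This
  turns the congruences of Euler's criterion into equalities.\<close>

lemma Legendre_eq_if_cong:
  assumes "[Legendre a (int p) = c] (mod p)" "c \<in> {-1, 0, 1}"
  shows "Legendre a (int p) = c"
proof -
  have "int p dvd Legendre a p - c" using assms(1) by (simp add: cong_iff_dvd_diff)
  moreover have "\<bar>Legendre a p - c\<bar> < int p" using Legendre_values[of a p] assms(2) p by auto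
  ultimately show ?thesis using dvd_imp_le_int[of "Legendre a p - c" "int p"] by force
qed

lemma Legendre_mult: "Legendre (a * b) (int p) = Legendre a p * Legendre b p"
proof (rule Legendre_eq_if_cong)
  have "[Legendre (a * b) p = (a * b) ^ ((p - 1) div 2)] (mod p)"
    using p by (rule euler_criterion)
  moreover have "[Legendre a p * Legendre b p = a ^ ((p - 1) div 2) * b ^ ((p - 1) div 2)] (mod p)"
    using p by (intro cong_mult euler_criterion)
  ultimately show "[Legendre (a * b) p = Legendre a p * Legendre b p] (mod p)"
    by (metis cong_sym cong_trans power_mult_distrib)
qed (use Legendre_values[of a p] Legendre_values[of b p] in auto)

lemma Legendre_minus_1:
  assumes "[p = 1] (mod 4)"
  shows "Legendre (- 1) (int p) = 1"
proof (rule Legendre_eq_if_cong)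
  obtain k where "p = 4 * k + 1" using assms p by (metis cong_def mod_less one_less_numeral_iff semiring_norm(76) mult_div_mod_eq)
  then have "even ((p - 1) div 2)" by simp
  then show "[Legendre (- 1) (int p) = 1] (mod p)"
    using euler_criterion[OF p, of "- 1"] by simp
qed simp

text \<open>If all nonzero residues were squares, squaring would map the finite set of nonzero
  residues onto itself, hence injectively; but 1 and \<open>p - 1\<close> have the same
  square.\<close>

lemma exists_Legendre_minus_1: "\<exists>g. Legendre g (int p) = - 1"
proof (rule ccontr)
  assume "\<not> ?thesis"
  then have all: "QuadRes p g" if "\<not> int p dvd g" for g
    using that by (auto simp: Legendre_def cong_0_iff split: if_splits)
  have nd: "\<not> int p dvd y" if "y \<in> {1..<int p}" for y
    using that by (auto dest: zdvd_imp_le)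
  define f where "f = (\<lambda>y. y\<^sup>2 mod int p)"
  have "{1..<int p} \<subseteq> f ` {1..<int p}"
  proof
    fix g assume g: "g \<in> {1..<int p}"
    then obtain y where y: "[y\<^sup>2 = g] (mod p)" using all nd unfolding QuadRes_def by blast
    then have fy: "f (y mod p) = g" using g by (simp add: f_def cong_def power_mod)
    have "y mod p \<noteq> 0" using fy g by (auto simp: f_def)
    moreover have "0 \<le> y mod p" "y mod p < p" using p by simp_all
    ultimately show "g \<in> f ` {1..<int p}" using fy
      by (intro image_eqI[of _ _ "y mod p"]) auto
  qed
  then have "inj_on f {1..<int p}"
    by (meson card_image_le eq_card_imp_inj_on finite_atLeastLessThan_int
        finite_surj card_mono finite_imageI le_antisym)
  moreover have "f (int p - 1) = f 1"
  proof -
    have "(int p - 1)\<^sup>2 = 1 + int p * (int p - 2)" by (simp add: power2_eq_square algebra_simps)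
    then show ?thesis by (simp only: f_def mod_mult_self2) simp
  qed
  ultimately show False using p by (auto dest!: inj_onD)
qed

text \<open>Multiplication by a non-residue \<open>g\<close> permutes the residues and changes the
  sign of every summand, so the sum equals its own negative.\<close>

lemma sum_Legendre: "(\<Sum>w\<in>{0..<int p}. Legendre w p) = 0"
proof -
  obtain g where g: "Legendre g (int p) = - 1" using exists_Legendre_minus_1 by blast
  have "coprime g p"
    using g p Legendre_eq_0_iff[of g p]
    by (metis coprime_commute neg_equal_0_iff_equal one_neq_zero prime_imp_coprime prime_nat_int_transfer)
  then have "(\<Sum>w\<in>{0..<int p}. Legendre w p) = (\<Sum>w\<in>{0..<int p}. Legendre (g * w + 0) p)"
    using p by (intro sum_affine_mod[symmetric]) auto
  then show ?thesis by (simp add: Legendre_mult g sum_negf)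
qed

lemma Legendre_square: "\<not> int p dvd c \<Longrightarrow> Legendre c p * Legendre c p = 1"
  using Legendre_values[of c p] Legendre_eq_0_iff[of c p] by auto

text \<open>Substituting \<open>c * w\<close> for \<open>w\<close> shows that \<open>T c\<close> is
  the same for all \<open>c\<close> not divisible by \<open>p\<close>. The sum of \<open>T c\<close>
  over all residues vanishes, while \<open>T 0 = p - 1\<close>, so each of the other
  \<open>p - 1\<close> equal values is -1.\<close>

lemma sum_Legendre_shift:
  assumes "\<not> int p dvd c"
  shows "(\<Sum>w\<in>{0..<int p}. Legendre w p * Legendre (w + c) p) = - 1"
proof -
  define T where "T c = (\<Sum>w\<in>{0..<int p}. Legendre w p * Legendre (w + c) p)" for c
  have T: "T c = T 1" if "\<not> int p dvd c" for c
  proof -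
    have "coprime c p"
      using that p by (metis coprime_commute prime_imp_coprime prime_nat_int_transfer)
    then have "T c = (\<Sum>w\<in>{0..<int p}. Legendre (c * w + 0) p * Legendre (c * w + 0 + c) p)"
      unfolding T_def using p
      by (intro sum_affine_mod[symmetric])
        (auto, metis Legendre_mod mod_add_left_eq)
    also have "\<dots> = (\<Sum>w\<in>{0..<int p}. Legendre c p * Legendre c p * (Legendre w p * Legendre (w + 1) p))"
    proof (rule sum.cong)
      fix w
      have "c * w + 0 + c = c * (w + 1)" by (simp add: algebra_simps)
      then show "Legendre (c * w + 0) p * Legendre (c * w + 0 + c) p =
          Legendre c p * Legendre c p * (Legendre w p * Legendre (w + 1) p)"
        by (simp add: Legendre_mult)
    qed simp
    also have "\<dots> = T 1" using that by (simp add: Legendre_square T_def)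
    finally show ?thesis .
  qed
  have nd: "\<not> int p dvd y" if "y \<in> {1..<int p}" for y
    using that by (auto dest: zdvd_imp_le)
  have split: "{0..<int p} = insert 0 {1..<int p}" using p by auto
  have "T 0 = (\<Sum>w\<in>{1..<int p}. 1)"
    unfolding T_def split using Legendre_eq_0_iff[of 0 p] nd by (simp add: Legendre_square)
  then have T0: "T 0 = int p - 1" using p by simp
  \<comment> \<open>For fixed \<open>w\<close> the inner sum over \<open>c\<close> is a translate of
    the complete character sum, which is 0.\<close>
  have "(\<Sum>c\<in>{0..<int p}. T c) = (\<Sum>w\<in>{0..<int p}. \<Sum>c\<in>{0..<int p}. Legendre w p * Legendre (w + c) p)"
    unfolding T_def by (rule sum.swap)
  also have "\<dots> = (\<Sum>w\<in>{0..<int p}. Legendre w p * (\<Sum>c\<in>{0..<int p}. Legendre (1 * c + w) p))"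
    by (simp add: sum_distrib_left add.commute)
  also have "\<dots> = 0"
    using p by (subst sum_affine_mod) (auto simp: sum_Legendre)
  finally have "T 0 + (\<Sum>c\<in>{1..<int p}. T c) = 0" by (simp add: split)
  moreover have "(\<Sum>c\<in>{1..<int p}. T c) = (\<Sum>c\<in>{1..<int p}. T 1)"
    by (intro sum.cong refl T nd)
  ultimately have "(int p - 1) * (T 1 + 1) = 0" using T0 p by (simp add: algebra_simps)
  then have "T 1 = - 1" using p by simp
  then show ?thesis using T[OF assms] by (simp add: T_def)
qed

end

section \<open>Strongly regular matrices\<close>

text \<open>The diagonal matrix \<open>D\<close> absorbs whatever the quadratic equation leaves on
  the diagonal, so only off-diagonal entries are constrained.\<close>

lemma solves_iff:
  assumes S: "S \<in> carrier_mat n n"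
  shows "solves n S \<theta> \<longleftrightarrow>
    (\<forall>i<n. \<forall>j<n. S $$ (i, j) = S $$ (j, i)) \<and>
    (\<forall>i<n. S $$ (i, i) = 0) \<and>
    (\<forall>i<n. (\<Sum>j<n. S $$ (i, j)) = 0) \<and>
    (\<forall>i<n. \<forall>j<n. i \<noteq> j \<longrightarrow>
      (S $$ (i, j))\<^sup>2 + (\<Sum>k<n. S $$ (i, k) * S $$ (k, j)) = \<theta> * S $$ (i, j))"
    (is "_ \<longleftrightarrow> ?sym \<and> ?diag \<and> ?rows \<and> ?sq")
proof -
  have dims [simp]: "dim_row S = n" "dim_col S = n" using S by auto
  have "S = transpose_mat S \<longleftrightarrow> ?sym"
    by (auto simp: mat_eq_iff)
  moreover have "S \<odot>\<^sub>m 1\<^sub>m n = 0\<^sub>m n n \<longleftrightarrow> ?diag"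
    by (auto simp: mat_eq_iff hadamard_def)
  moreover have "S * all_one_mat n = 0\<^sub>m n n \<longleftrightarrow> ?rows"
    by (auto simp: mat_eq_iff all_one_mat_def scalar_prod_def lessThan_atLeast0)
  moreover have "(\<exists>D \<in> carrier_mat n n. diagonal_mat D \<and> S \<odot>\<^sub>m S + S * S = \<theta> \<cdot>\<^sub>m S + D) \<longleftrightarrow> ?sq"
  proof
    assume "\<exists>D \<in> carrier_mat n n. diagonal_mat D \<and> S \<odot>\<^sub>m S + S * S = \<theta> \<cdot>\<^sub>m S + D"
    then obtain D where D: "D \<in> carrier_mat n n" "diagonal_mat D"
      "S \<odot>\<^sub>m S + S * S = \<theta> \<cdot>\<^sub>m S + D" by blast
    show ?sq
    proof (intro allI impI)
      fix i j assume ij: "i < n" "j < n" "i \<noteq> j"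
      have "(S \<odot>\<^sub>m S + S * S) $$ (i, j) = (\<theta> \<cdot>\<^sub>m S + D) $$ (i, j)" using D(3) by simp
      moreover have "D $$ (i, j) = 0" using D(1,2) ij by (auto simp: diagonal_mat_def)
      ultimately show "(S $$ (i, j))\<^sup>2 + (\<Sum>k<n. S $$ (i, k) * S $$ (k, j)) = \<theta> * S $$ (i, j)"
        using ij D(1)
        by (simp add: hadamard_def scalar_prod_def lessThan_atLeast0 power2_eq_square)
    qed
  next
    assume sq: ?sq
    define D where "D = mat n n (\<lambda>(i, j). if i = j
      then (S $$ (i, j))\<^sup>2 + (\<Sum>k<n. S $$ (i, k) * S $$ (k, j)) - \<theta> * S $$ (i, j) else 0)"
    have "S \<odot>\<^sub>m S + S * S = \<theta> \<cdot>\<^sub>m S + D"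
      using sq by (intro eq_matI)
        (auto simp: hadamard_def scalar_prod_def lessThan_atLeast0 power2_eq_square D_def)
    moreover have "D \<in> carrier_mat n n" "diagonal_mat D"
      by (auto simp: D_def diagonal_mat_def)
    ultimately show "\<exists>D \<in> carrier_mat n n. diagonal_mat D \<and> S \<odot>\<^sub>m S + S * S = \<theta> \<cdot>\<^sub>m S + D"
      by blast
  qed
  ultimately show ?thesis using S by (simp add: solves_def)
qed

lemma two_valued_commute: "two_valued S x y \<longleftrightarrow> two_valued S y x"
  by (auto simp: two_valued_def)

lemma two_valued_eq: "two_valued S x y \<Longrightarrow> i < dim_row S \<Longrightarrow> j < dim_col S \<Longrightarrow> i \<noteq> j \<Longrightarrow>
    S $$ (i, j) = x \<or> S $$ (i, j) = y"
  by (auto simp: two_valued_def off_diagonal_entries_def)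

lemma two_valued_obtain:
  assumes "two_valued S x y"
  obtains i j where "i < dim_row S" "j < dim_col S" "i \<noteq> j" "S $$ (i, j) = x"
proof -
  have "x \<in> off_diagonal_entries S" using assms by (auto simp: two_valued_def)
  then show ?thesis using that by (auto simp: off_diagonal_entries_def)
qed

section \<open>Adjacency matrices as symmetric 0-1 matrices\<close>

locale symmetric_01 =
  fixes n :: nat and a :: "nat \<Rightarrow> nat \<Rightarrow> real"
  assumes zero_one: "i < n \<Longrightarrow> j < n \<Longrightarrow> a i j = 0 \<or> a i j = 1"
    and sym: "i < n \<Longrightarrow> j < n \<Longrightarrow> a i j = a j i"
    and diag: "i < n \<Longrightarrow> a i i = 0"
begin

lemma diag_square: "i < n \<Longrightarrow> (\<Sum>k<n. a i k * a k i) = (\<Sum>k<n. a i k)"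
proof (intro sum.cong refl)
  fix k assume "i < n" "k \<in> {..<n}"
  then show "a i k * a k i = a i k" using zero_one[of i k] sym[of i k] by auto
qed

lemma sum_eq_card: "i < n \<Longrightarrow> (\<Sum>k<n. a i k) = real (card {k. k < n \<and> a i k = 1})"
proof -
  assume i: "i < n"
  have "(\<Sum>k<n. a i k) = (\<Sum>k<n. if a i k = 1 then 1 else 0)"
    using zero_one[OF i] by (intro sum.cong) auto
  also have "\<dots> = real (card {k \<in> {..<n}. a i k = 1})" by (simp flip: sum.inter_filter)
  finally show ?thesis by simp
qed

lemma square_eq_card:
  assumes "i < n" "j < n"
  shows "(\<Sum>k<n. a i k * a k j) = real (card {k. k < n \<and> a i k = 1 \<and> a j k = 1})"
proof -
  have "(\<Sum>k<n. a i k * a k j) = (\<Sum>k<n. if a i k = 1 \<and> a j k = 1 then 1 else 0)"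
  proof (intro sum.cong refl)
    fix k assume "k \<in> {..<n}"
    then show "a i k * a k j = (if a i k = 1 \<and> a j k = 1 then 1 else 0)"
      using zero_one[of i k] zero_one[of j k] sym[of j k] assms by auto
  qed
  also have "\<dots> = real (card {k \<in> {..<n}. a i k = 1 \<and> a j k = 1})"
    by (simp flip: sum.inter_filter)
  finally show ?thesis by simp
qed

lemma combination_square:
  assumes rows: "\<And>i. i < n \<Longrightarrow> (\<Sum>k<n. a i k) = d"
    and ij: "i < n" "j < n" "i \<noteq> j"
    and s: "\<And>i j. i < n \<Longrightarrow> j < n \<Longrightarrow> s i j = z * a i j + y * of_bool (i \<noteq> j)"
  shows "(\<Sum>k<n. s i k * s k j) =
    z\<^sup>2 * (\<Sum>k<n. a i k * a k j) + 2 * z * y * (d - a i j) + y\<^sup>2 * (real n - 2)"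
proof -
  have cols: "(\<Sum>k<n. a k j) = d" using rows[of j] sym[of _ j] ij by simp
  \<comment> \<open>Expand as if K were the all-one matrix, then remove the surplus at
    \<open>k = j\<close> and \<open>k = i\<close>, where the diagonal entry of \<open>s\<close> is
    0.\<close>
  have "(\<Sum>k<n. s i k * s k j) = (\<Sum>k<n. z\<^sup>2 * (a i k * a k j) + z * y * a i k + z * y * a k j + y\<^sup>2
      - (if k = j then z * y * a i k + y\<^sup>2 else 0) - (if k = i then z * y * a k j + y\<^sup>2 else 0))"
    using ij s diag by (intro sum.cong) (auto simp: algebra_simps power2_eq_square)
  also have "\<dots> = z\<^sup>2 * (\<Sum>k<n. a i k * a k j) + z * y * d + z * y * d + real n * y\<^sup>2
      - (z * y * a i j + y\<^sup>2) - (z * y * a i j + y\<^sup>2)"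
    using ij by (simp add: sum.distrib sum_subtractf rows cols flip: sum_distrib_left)
  also have "\<dots> = z\<^sup>2 * (\<Sum>k<n. a i k * a k j) + 2 * z * y * (d - a i j) + y\<^sup>2 * (real n - 2)"
    by (simp add: algebra_simps)
  finally show ?thesis .
qed

lemma sum_combination:
  assumes "i < n" "\<And>j. j < n \<Longrightarrow> s i j = z * a i j + y * of_bool (i \<noteq> j)"
  shows "(\<Sum>j<n. s i j) = z * (\<Sum>j<n. a i j) + y * (real n - 1)"
proof -
  have "(\<Sum>j<n. s i j) = (\<Sum>j<n. z * a i j + y - (if j = i then y else 0))"
    using assms by (intro sum.cong) auto
  also have "\<dots> = z * (\<Sum>j<n. a i j) + y * (real n - 1)"
    using assms(1) by (simp add: sum.distrib sum_subtractf algebra_simps flip: sum_distrib_left)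
  finally show ?thesis .
qed

end

text \<open>Strong regularity expressed through the entries of A and its square. The bounds on
  \<open>r\<close> exclude the empty and the complete graph, so that both an edge and a non-edge
  exist.\<close>

locale srg_matrix = symmetric_01 +
  fixes r l m :: nat
  assumes degree: "i < n \<Longrightarrow> (\<Sum>k<n. a i k) = real r"
    and adjacent: "i < n \<Longrightarrow> j < n \<Longrightarrow> a i j = 1 \<Longrightarrow> (\<Sum>k<n. a i k * a k j) = real l"
    and non_adjacent: "i < n \<Longrightarrow> j < n \<Longrightarrow> i \<noteq> j \<Longrightarrow> a i j = 0 \<Longrightarrow> (\<Sum>k<n. a i k * a k j) = real m"
    and r_pos: "0 < r" and r_less: "r < n - 1"
begin

text \<open>The diagonal, adjacent and non-adjacent cases merge into one matrix identity. It makes A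
  a root of a quadratic on the orthogonal complement of the all-one vector.\<close>

lemma square: "i < n \<Longrightarrow> j < n \<Longrightarrow> (\<Sum>k<n. a i k * a k j) =
    (real l - real m) * a i j + real m + (if i = j then real r - real m else 0)"
  using diag[of i] diag_square[of i] degree[of i]
    zero_one[of i j] adjacent[of i j] non_adjacent[of i j]
  by (cases "i = j"; cases "a i j = 0") simp_all

lemma n_pos: "0 < n"
  using r_less by simp

lemma obtain_adjacent: obtains j where "j < n" "a 0 j = 1"
proof -
  have "(\<Sum>k<n. a 0 k) \<noteq> 0" using degree[OF n_pos] r_pos by simp
  then obtain j where "j < n" "a 0 j \<noteq> 0" by (meson lessThan_iff sum.neutral)
  then show ?thesis using that zero_one[OF n_pos] by blast
qed

lemma obtain_non_adjacent: obtains j where "j < n" "j \<noteq> 0" "a 0 j = 0"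
proof -
  have "\<exists>j<n. j \<noteq> 0 \<and> a 0 j = 0"
  proof (rule ccontr)
    assume "\<not> ?thesis"
    then have "(\<Sum>k<n. a 0 k) = (\<Sum>k<n. 1 - (if k = 0 then 1 else 0))"
      using zero_one[OF n_pos] diag[OF n_pos] by (intro sum.cong) auto
    also have "\<dots> = real n - 1" using n_pos by (simp add: sum_subtractf)
    finally show False using degree[OF n_pos] r_less by simp
  qed
  then show ?thesis using that by blast
qed

text \<open>The common neighbors of 0 and an adjacent \<open>j\<close> are neighbors of 0 other than
  \<open>j\<close> itself.\<close>

lemma l_less: "l < r"
proof -
  obtain j where j: "j < n" "a 0 j = 1" using obtain_adjacent by blast
  have "real l = (\<Sum>k<n. a 0 k * a k j)" using adjacent[OF n_pos j] by simp
  also have "\<dots> \<le> (\<Sum>k<n. a 0 k - (if k = j then 1 else 0))"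
  proof (rule sum_mono)
    fix k assume "k \<in> {..<n}"
    then show "a 0 k * a k j \<le> a 0 k - (if k = j then 1 else 0)"
      using zero_one[OF n_pos, of k] zero_one[of k j] j diag[of j] by auto
  qed
  also have "\<dots> = real r - 1" using j degree[OF n_pos] by (simp add: sum_subtractf)
  finally show ?thesis by simp
qed

lemma m_le: "m \<le> r"
proof -
  obtain j where j: "j < n" "j \<noteq> 0" "a 0 j = 0" using obtain_non_adjacent by blast
  have "real m = (\<Sum>k<n. a 0 k * a k j)" using non_adjacent[OF n_pos] j by simp
  also have "\<dots> \<le> (\<Sum>k<n. a 0 k)"
  proof (rule sum_mono)
    fix k assume "k \<in> {..<n}"
    then show "a 0 k * a k j \<le> a 0 k"
      using zero_one[OF n_pos, of k] zero_one[of k j] j by auto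
  qed
  finally show ?thesis using degree[OF n_pos] by simp
qed

text \<open>Double counting of the walks of length 2 that start at vertex 0: once by degrees, once
  by their end point.\<close>

lemma parameter_identity:
  "(real n - 1 - real r) * real m = real r * (real r - 1 - real l)"
proof -
  have "(\<Sum>j<n. \<Sum>k<n. a 0 k * a k j) = (\<Sum>k<n. a 0 k * (\<Sum>j<n. a k j))"
    by (subst sum.swap) (simp add: sum_distrib_left)
  also have "\<dots> = (\<Sum>k<n. a 0 k * real r)" by (simp add: degree)
  also have "\<dots> = real r * real r" using degree[OF n_pos] by (simp flip: sum_distrib_right)
  finally have "real r * real r = (\<Sum>j<n. \<Sum>k<n. a 0 k * a k j)" by simp
  also have "\<dots> = (\<Sum>j<n. (real l - real m) * a 0 j + real m + (if j = 0 then real r - real m else 0))"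
    using n_pos by (intro sum.cong) (auto simp: square)
  also have "\<dots> = (real l - real m) * real r + real n * real m + (real r - real m)"
    using n_pos degree[OF n_pos] by (simp add: sum.distrib flip: sum_distrib_left)
  finally show ?thesis by (simp add: algebra_simps)
qed

end

section \<open>Strongly regular graphs of prime order\<close>

lemma nat_square_if_rational_sqrt:
  fixes D u v :: int
  assumes "v \<noteq> 0" "v\<^sup>2 * D = u\<^sup>2"
  shows "\<exists>d::nat. D = (int d)\<^sup>2"
proof -
  have "v\<^sup>2 dvd u\<^sup>2" using assms(2) by (metis dvd_triv_left)
  then have "v dvd u" by simp
  then obtain k where "u = v * k" by blast
  then have "v\<^sup>2 * D = v\<^sup>2 * k\<^sup>2" using assms(2) by (simp add: power_mult_distrib)
  then have "D = k\<^sup>2" using assms(1) by simp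
  then show ?thesis by (intro exI[of _ "nat \<bar>k\<bar>"]) simp
qed

text \<open>Here \<open>value_at_r\<close> is the quadratic with roots \<open>s\<close> and
  \<open>t\<close> evaluated at \<open>r\<close>, and \<open>f\<close> in \<open>trace\<close> is
  the multiplicity of \<open>s\<close>. For \<open>m > 0\<close> the prime \<open>n\<close> would
  divide one of two numbers strictly between 0 and \<open>n\<close>.\<close>

lemma integral_eigenvalues_not_prime:
  fixes n r l m f :: nat and s t :: int
  assumes n: "prime n" and r: "0 < r" "2 * r < n" and "l < r" "m \<le> r"
    and sum: "s + t = int l - int m" and prod: "s * t = int m - int r" and "t \<le> s"
    and value_at_r: "(int r - s) * (int r - t) = int n * int m"
    and trace: "m = 0 \<Longrightarrow> - (int n - 1) * t - int r = int f * (s - t)"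
  shows False
proof -
  have st: "s * t \<le> 0" using prod \<open>m \<le> r\<close> by simp
  have s: "0 \<le> s" using st \<open>t \<le> s\<close> by (smt (verit) mult_neg_neg)
  have t: "t \<le> 0" using st \<open>t \<le> s\<close> by (smt (verit) mult_pos_pos)
  show False
  proof (cases "m = 0")
    \<comment> \<open>The case of disjoint cliques: \<open>f + 1\<close> of them, each with
      \<open>r + 1\<close> vertices.\<close>
    case True
    then have "s = int r" using value_at_r t r by simp
    then have "int r * (t + 1) = 0" using prod True by (simp add: algebra_simps)
    then have "t = - 1" using r by simp
    then have "int n = (int f + 1) * (int r + 1)"
      using trace[OF True] \<open>s = int r\<close> by (simp add: algebra_simps)
    then have "n = (f + 1) * (r + 1)" by (simp flip: of_nat_Suc of_nat_mult add: algebra_simps)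
    moreover have "f \<noteq> 0" using calculation r by (cases f) auto
    ultimately show False using n r prime_product[of "f + 1" "r + 1"] by auto
  next
    case False
    have "s < int r"
    proof (cases "t = 0")
      case True
      then show ?thesis using sum \<open>l < r\<close> by linarith
    next
      case False
      \<comment> \<open>Hence \<open>s\<close> is at most \<open>- s * t = r - m\<close>, which is
        below \<open>r\<close>. Below, \<open>- t\<close> is bounded in the same way.\<close>
      then have "0 \<le> s * (- t - 1)" using s t by simp
      then show ?thesis using prod \<open>m \<noteq> 0\<close> by (simp add: algebra_simps)
    qed
    moreover have "- t \<le> int r"
    proof (cases "s = 0")
      case True
      then show ?thesis using sum prod by simp
    next
      case False
      then have "0 \<le> (s - 1) * (- t)" using s t by (intro mult_nonneg_nonneg) auto
      then show ?thesis using prod by (simp add: algebra_simps)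
    qed
    moreover have "int n dvd int r - s \<or> int n dvd int r - t"
      using value_at_r n by (metis dvd_triv_left prime_dvd_mult_iff prime_nat_int_transfer)
    ultimately show False using s t r by (auto dest: zdvd_imp_le)
  qed
qed

section \<open>Eigenvalue multiplicities and conference parameters\<close>

context srg_matrix
begin

text \<open>The parameter identity, read as the value at \<open>r\<close> of the quadratic with
  roots \<open>s\<close> and \<open>t\<close>.\<close>

lemma n_times_m: "(real r)\<^sup>2 - (real l - real m) * real r - (real r - real m) = real n * real m"
  using parameter_identity by (simp add: algebra_simps power2_eq_square)

text \<open>The number \<open>f\<close> is the multiplicity of the eigenvalue \<open>s\<close>, obtained as the trace of the
  orthogonal projection onto its eigenspace.\<close>

lemma eigenvalue_multiplicity:
  fixes s t :: real
  assumes sum: "s + t = real l - real m" and prod: "s * t = real m - real r" and "s \<noteq> t"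
  shows "\<exists>f::nat. - (real n - 1) * t - real r = real f * (s - t)"
proof -
  \<comment> \<open>With this \<open>q\<close> the matrix \<open>A - t 1 - q J\<close> kills the
    all-one vector, whose eigenvalue under A is \<open>r\<close>.\<close>
  define q where "q = (real r - t) / real n"
  have nq: "real n * q = real r - t" using n_pos by (simp add: q_def)
  have "real n * real m = (real r - s) * (real r - t)"
  proof -
    have "(real r - s) * (real r - t) = (real r)\<^sup>2 - (s + t) * real r + s * t"
      by (simp add: algebra_simps power2_eq_square)
    then show ?thesis using n_times_m by (simp add: sum prod)
  qed
  also have "(real r - s) * (real r - t) = real n * ((real r - s) * q)"
    by (simp add: mult.left_commute nq)
  finally have m: "real m = (real r - s) * q" using n_pos by simp
  have nqq: "real n * (q * q) = (real r - t) * q" by (simp add: nq flip: mult.assoc)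
  \<comment> \<open>This matrix vanishes on the all-one vector and on the eigenspace of
    \<open>t\<close>, and acts as \<open>s - t\<close> on that of \<open>s\<close>; divided by
    \<open>s - t\<close> it is the projection.\<close>
  define e where "e i j = a i j - (if i = j then t else 0) - q" for i j
  have e: "(\<Sum>k<n. e i k * e k j) = (s - t) * e i j" if ij: "i < n" "j < n" for i j
  proof -
    have cols: "(\<Sum>k<n. a k j) = real r" using degree[of j] sym[of _ j] ij by simp
    \<comment> \<open>The terms with \<open>t\<close> occur only at \<open>k = j\<close> and
      \<open>k = i\<close>; the product \<open>t * t\<close>, present when \<open>i = j\<close>, is
      booked under \<open>k = j\<close>.\<close>
    have "(\<Sum>k<n. e i k * e k j) = (\<Sum>k<n. a i k * a k j - q * a i k - q * a k j + q * q
        - (if k = j then t * a i k - t * q - (if i = j then t * t else 0) else 0)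
        - (if k = i then t * a k j - t * q else 0))"
      by (intro sum.cong) (auto simp: e_def algebra_simps)
    also have "\<dots> = (\<Sum>k<n. a i k * a k j) - q * real r - q * real r + real n * (q * q)
        - (t * a i j - t * q - (if i = j then t * t else 0)) - (t * a i j - t * q)"
      using ij by (simp add: sum.distrib sum_subtractf degree cols flip: sum_distrib_left)
    also have "\<dots> = (s + t) * a i j + real m + (if i = j then - (s * t) else 0)
        - 2 * q * real r + (real r - t) * q
        - 2 * t * a i j + 2 * t * q + (if i = j then t * t else 0)"
      using ij by (simp add: square sum prod nqq)
    also have "\<dots> = (s - t) * e i j"
      unfolding m by (simp add: e_def algebra_simps)
    finally show ?thesis .
  qed
  have "\<exists>f::nat. (\<Sum>i<n. e i i / (s - t)) = real f"
  proof (rule idempotent_trace_nat[where e = "\<lambda>i j. e i j / (s - t)"])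
    fix i j assume "i < n" "j < n"
    then show "(\<Sum>k<n. e i k / (s - t) * (e k j / (s - t))) = e i j / (s - t)"
      using \<open>s \<noteq> t\<close> e[of i j] by (simp flip: sum_divide_distrib)
  qed
  then obtain f :: nat where f: "(\<Sum>i<n. e i i / (s - t)) = real f" by blast
  have "(\<Sum>i<n. e i i) = (\<Sum>i<n. - t - q)" by (intro sum.cong) (simp_all add: e_def diag)
  also have "\<dots> = - (real n - 1) * t - real r"
    using nq by (simp add: algebra_simps)
  finally show ?thesis using f \<open>s \<noteq> t\<close>
    by (intro exI[of _ f]) (simp add: field_simps flip: sum_divide_distrib)
qed

text \<open>If the discriminant \<open>D\<close> is a square, the eigenvalues are integers, which
  primality excludes. Otherwise its root \<open>w\<close> is irrational, and the multiplicity
  formula, linear in \<open>w\<close> with integer coefficients, can hold only if both coefficients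
  vanish.\<close>

lemma prime_imp_conference:
  assumes n: "prime n" and "2 * r < n"
  shows "m = l + 1" "n = 4 * m + 1"
proof -
  define c where "c = int l - int m"
  define D where "D = c\<^sup>2 + 4 * (int r - int m)"
  have D_nonneg: "0 \<le> D" using m_le by (simp add: D_def)
  have not_square: False if "D = (int d)\<^sup>2" for d :: nat
  proof -
    \<comment> \<open>\<open>D\<close> and the square of \<open>c\<close> have the same parity, so
      the root \<open>s = (c + d) / 2\<close> is an integer.\<close>
    have "even (c + int d)"
    proof -
      have "even (D - c\<^sup>2)" by (simp add: D_def)
      then show ?thesis using that by simp
    qed
    then obtain s where s: "c + int d = 2 * s" by blast
    define t where "t = c - s"
    have d: "int d = s - t" using s by (simp add: t_def)
    have c: "s + t = c" by (simp add: t_def)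
    have "4 * (s * t) = (s + t)\<^sup>2 - (s - t)\<^sup>2" by (simp add: algebra_simps power2_eq_square)
    then have prod: "s * t = int m - int r" using that by (simp add: c D_def flip: d)
    have "real_of_int ((int r - s) * (int r - t)) =
        (real r)\<^sup>2 - of_int (s + t) * real r + of_int (s * t)"
      by (simp add: algebra_simps power2_eq_square)
    also have "\<dots> = of_int (int n * int m)"
      using n_times_m unfolding c prod by (simp add: c_def algebra_simps)
    finally have value_at_r: "(int r - s) * (int r - t) = int n * int m" by (simp only: of_int_eq_iff)
    \<comment> \<open>The multiplicity formula requires \<open>s \<noteq> t\<close>. Equal roots
      would make \<open>s * t\<close> nonnegative, whereas it equals \<open>- r\<close> when
      \<open>m = 0\<close>.\<close>
    have "\<exists>f::nat. m = 0 \<longrightarrow> - (int n - 1) * t - int r = int f * (s - t)"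
    proof (cases "s = t")
      case True
      then have "s * t \<ge> 0" by simp
      then have "m \<noteq> 0" using prod r_pos by auto
      then show ?thesis by blast
    next
      case False
      have "real_of_int s + real_of_int t = real l - real m"
        using arg_cong[OF c, of real_of_int] by (simp add: c_def)
      moreover have "real_of_int s * real_of_int t = real m - real r"
        using arg_cong[OF prod, of real_of_int] by simp
      ultimately obtain f :: nat where "- (real n - 1) * of_int t - real r = real f * (of_int s - of_int t)"
        using eigenvalue_multiplicity False by (metis of_int_eq_iff)
      then have "real_of_int (- (int n - 1) * t - int r) = of_int (int f * (s - t))" by simp
      then show ?thesis by (metis of_int_eq_iff)
    qed
    then obtain f :: nat where f: "m = 0 \<Longrightarrow> - (int n - 1) * t - int r = int f * (s - t)" by blast
    show False
      by (rule integral_eigenvalues_not_prime[OF n r_pos assms(2) l_less m_le _ prod _ value_at_r f])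
        (use c d in \<open>auto simp: c_def\<close>)
  qed
  define w where "w = sqrt (real_of_int D)"
  have w2: "w * w = real_of_int D" using D_nonneg by (simp add: w_def)
  have "D \<noteq> 0" using not_square[of 0] by auto
  then have "w \<noteq> 0" by (simp add: w_def)
  define s t where "s = (of_int c + w) / 2" and "t = (of_int c - w) / 2"
  have st: "s + t = real l - real m" by (simp add: s_def t_def c_def field_simps)
  have "s * t = (of_int c * of_int c - w * w) / 4" by (simp add: s_def t_def algebra_simps)
  then have "s * t = real m - real r" unfolding w2 by (simp add: D_def power2_eq_square)
  moreover have "s - t = w" by (simp add: s_def t_def field_simps)
  ultimately obtain f :: nat where f: "- (real n - 1) * t - real r = real f * w"
    using eigenvalue_multiplicity[OF st] \<open>w \<noteq> 0\<close> by auto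
  \<comment> \<open>Twice the multiplicity formula, sorted by powers of \<open>w\<close>, reads
    \<open>v * w = u\<close>. A nonzero \<open>v\<close> would make \<open>w\<close> rational and
    \<open>D\<close> a square.\<close>
  define u v where "u = - (int n - 1) * c - 2 * int r" and "v = 2 * int f - (int n - 1)"
  have uv: "of_int v * w = of_int u"
    using f by (simp add: u_def v_def t_def field_simps)
  have "v = 0"
  proof (rule ccontr)
    assume "v \<noteq> 0"
    have "real_of_int (v\<^sup>2 * D) = (of_int v * w) * (of_int v * w)"
      by (simp add: power2_eq_square w2[symmetric])
    also have "\<dots> = of_int (u\<^sup>2)" unfolding uv by (simp add: power2_eq_square)
    finally have "v\<^sup>2 * D = u\<^sup>2" by (simp only: of_int_eq_iff)
    then show False using nat_square_if_rational_sqrt[OF \<open>v \<noteq> 0\<close>] not_square by blast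
  qed
  then have "u = 0" using uv by simp
  then have eq: "(int n - 1) * (int m - int l) = 2 * int r"
    by (simp add: u_def c_def algebra_simps)
  \<comment> \<open>As \<open>2 * r\<close> is positive and at most \<open>n - 1\<close>, the factor
    \<open>m - l\<close> can only be 1; this also gives \<open>n - 1 = 2 * r\<close>.\<close>
  have "0 < int n - 1" "2 * int r < int n" using r_less assms(2) by simp_all
  then have "0 < int m - int l" using eq r_pos by (metis of_nat_0_less_iff zero_less_mult_pos mult_pos_pos zero_less_numeral)
  moreover have "int m - int l < 2"
  proof (rule ccontr)
    assume "\<not> ?thesis"
    then have "(int n - 1) * 2 \<le> (int n - 1) * (int m - int l)"
      using \<open>0 < int n - 1\<close> by (intro mult_left_mono) auto
    then have "(int n - 1) * 2 \<le> 2 * int r" by (simp only: eq)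
    then show False using \<open>2 * int r < int n\<close> \<open>0 < int n - 1\<close> by presburger
  qed
  ultimately show m: "m = l + 1" by linarith
  then have n2: "real n - 1 = 2 * real r" using eq by (simp add: of_nat_diff)
  then have "real r * real m = real r * (real r - real m)"
    using parameter_identity m by (simp add: algebra_simps)
  then have "real r = 2 * real m" using r_pos by simp
  then show "n = 4 * m + 1" using n2 by linarith
qed

section \<open>Solutions built from strongly regular matrices\<close>

lemma solves_combination:
  assumes S: "S \<in> carrier_mat n n"
    and s: "\<And>i j. i < n \<Longrightarrow> j < n \<Longrightarrow> S $$ (i, j) = z * a i j + y * of_bool (i \<noteq> j)"
    and zy: "real r * z + (real n - 1) * y = 0"
  shows "solves n S (z * (real l - real m + 1))"
proof -
  have "(S $$ (i, j))\<^sup>2 + (\<Sum>k<n. S $$ (i, k) * S $$ (k, j)) = z * (real l - real m + 1) * S $$ (i, j)"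
    if ij: "i < n" "j < n" "i \<noteq> j" for i j
  proof -
    \<comment> \<open>Once \<open>2\<close> has eliminated the square of \<open>y\<close>, the
      equations at adjacent and at non-adjacent pairs both reduce to this one. Multiplying by
      \<open>n - 1\<close> replaces \<open>y\<close> by a multiple of \<open>z\<close> and leaves
      the parameter identity.\<close>
    have 1: "z * z * real m + y * z * real r - z * (real l - real m + 1) * y = 0"
    proof -
      have "(real n - 1) * (z * z * real m + y * z * real r - z * (real l - real m + 1) * y) = 0"
      proof -
        have y: "(real n - 1) * y = - real r * z" using zy by simp
        have "(real n - 1) * (z * z * real m + y * z * real r - z * (real l - real m + 1) * y) =
            z * (z * ((real n - 1) * real m) + ((real n - 1) * y) * (real r - (real l - real m + 1)))"
          by (simp add: algebra_simps)
        also have "\<dots> = z * z * ((real n - 1 - real r) * real m - real r * (real r - 1 - real l))"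
          unfolding y by (simp add: algebra_simps)
        finally show ?thesis using parameter_identity by simp
      qed
      moreover have "real n - 1 \<noteq> 0" using r_less by simp
      ultimately show ?thesis by (simp only: mult_eq_0_iff) simp
    qed
    have 2: "(real n - 1) * y * y = - real r * z * y"
      using zy by (metis add_eq_0_iff mult_minus_left)
    have ss: "(\<Sum>k<n. S $$ (i, k) * S $$ (k, j)) =
      z\<^sup>2 * (\<Sum>k<n. a i k * a k j) + 2 * z * y * (real r - a i j) + y\<^sup>2 * (real n - 2)"
      by (rule combination_square[where s = "\<lambda>i j. S $$ (i, j)"]) (use degree s ij in auto)
    show ?thesis
      unfolding ss unfolding square[OF ij(1,2)] s[OF ij(1,2)]
      using 1 2 zero_one[of i j] ij
      by (auto simp: algebra_simps power2_eq_square)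
  qed
  moreover have "(\<Sum>j<n. S $$ (i, j)) = 0" if "i < n" for i
    using sum_combination[of i "\<lambda>i j. S $$ (i, j)" z y] that degree s zy by (simp add: algebra_simps)
  ultimately show ?thesis
    using S s diag sym by (simp add: solves_iff)
qed

lemma norm2_combination:
  assumes S: "S \<in> carrier_mat n n"
    and s: "\<And>i j. i < n \<Longrightarrow> j < n \<Longrightarrow> S $$ (i, j) = z * a i j + y * of_bool (i \<noteq> j)"
    and zy: "real r * z + (real n - 1) * y = 0"
  shows "norm2_mat S = \<bar>z\<bar> * sqrt (real n * real r * (real n - real r - 1) / (real n - 1))"
proof -
  have n1: "real n - 1 > 0" using r_less by simp
  have y: "y = - real r * z / (real n - 1)" using zy n1 by (simp add: field_simps)
  have row: "(\<Sum>j<n. (S $$ (i, j))\<^sup>2) = z\<^sup>2 * (real r * (real n - real r - 1) / (real n - 1))" if i: "i < n" for i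
  proof -
    \<comment> \<open>Because entries of A equal their squares, the squared entries again form a
      combination of A and K.\<close>
    have "(\<Sum>j<n. (S $$ (i, j))\<^sup>2) = (\<Sum>j<n. (z\<^sup>2 + 2 * z * y) * a i j + y\<^sup>2 * of_bool (i \<noteq> j))"
    proof (rule sum.cong)
      fix j assume "j \<in> {..<n}"
      then show "(S $$ (i, j))\<^sup>2 = (z\<^sup>2 + 2 * z * y) * a i j + y\<^sup>2 * of_bool (i \<noteq> j)"
        using i zero_one[of i j] diag[of i] by (auto simp: s power2_eq_square algebra_simps)
    qed simp
    also have "\<dots> = (z\<^sup>2 + 2 * z * y) * real r + y\<^sup>2 * (real n - 1)"
      using sum_combination[of i "\<lambda>i j. (z\<^sup>2 + 2 * z * y) * a i j + y\<^sup>2 * of_bool (i \<noteq> j)"] i degree by simp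
    also have "\<dots> = z\<^sup>2 * (real r * (real n - real r - 1) / (real n - 1))"
    proof -
      \<comment> \<open>The substitution \<open>z = w * v\<close>, \<open>y = - r * w\<close> clears
        the denominator \<open>n - 1\<close> from \<open>y\<close>.\<close>
      define v w where "v = real n - 1" and "w = z / v"
      have v: "v \<noteq> 0" "real n - real r - 1 = v - real r" using n1 by (simp_all add: v_def)
      have z: "z = w * v" using v by (simp add: w_def)
      have "((w * v)\<^sup>2 + 2 * (w * v) * (- real r * w)) * real r + (- real r * w)\<^sup>2 * v =
          (w * v)\<^sup>2 * (real r * (v - real r) / v)"
        using v by (simp add: field_simps power2_eq_square)
      moreover have "y = - real r * w" unfolding y v_def w_def by simp
      ultimately show ?thesis unfolding v(2) v_def[symmetric] by (simp only: z)
    qed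

    finally show ?thesis .
  qed
  have "(\<Sum>i<n. \<Sum>j<n. (S $$ (i, j))\<^sup>2) = z\<^sup>2 * (real n * real r * (real n - real r - 1) / (real n - 1))"
    by (simp add: row)
  then show ?thesis using S by (simp add: norm2_mat_def real_sqrt_mult real_sqrt_divide)
qed

end

text \<open>Zero row sums and \<open>z \<noteq> 0\<close> make all degrees equal. The quadratic
  equation then expresses an off-diagonal entry of the square of A through the corresponding entry
  of A alone.\<close>

lemma solves_two_valued_imp_srg_matrix:
  assumes "solves n S \<theta>" and two: "two_valued S x y"
  defines "a \<equiv> \<lambda>i j. of_bool (i \<noteq> j \<and> S $$ (i, j) = x) :: real"
  obtains r l m where "srg_matrix n a r l m"
    "real r * (x - y) + (real n - 1) * y = 0" "\<theta> = (x - y) * (real l - real m + 1)"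
proof -
  have S: "S \<in> carrier_mat n n" using assms(1) by (simp add: solves_def)
  have dims: "dim_row S = n" "dim_col S = n" using S by auto
  note sol = assms(1)[unfolded solves_iff[OF S]]
  define z where "z = x - y"
  have z: "z \<noteq> 0" using two by (simp add: z_def two_valued_def)
  interpret symmetric_01 n a
  proof
    show "a i j = a j i" if "i < n" "j < n" for i j
      using sol that by (auto simp: a_def)
  qed (auto simp: a_def)
  have s: "S $$ (i, j) = z * a i j + y * of_bool (i \<noteq> j)" if "i < n" "j < n" for i j
    using two_valued_eq[OF two, of i j] sol that by (auto simp: dims a_def z_def)
  \<comment> \<open>A pair with value \<open>x\<close> and one with value \<open>y\<close> serve as
    reference edge and non-edge; \<open>r\<close>, \<open>l\<close> and \<open>m\<close> are counted
    there.\<close>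
  obtain u v where uv: "u < n" "v < n" "u \<noteq> v" "S $$ (u, v) = x"
    using two_valued_obtain[OF two] dims by metis
  obtain u' v' where uv': "u' < n" "v' < n" "u' \<noteq> v'" "S $$ (u', v') = y"
    using two_valued_obtain[of S y x] two two_valued_commute dims by metis
  have "x \<noteq> y" using z by (simp add: z_def)
  have auv: "a u v = 1" "a u' v' = 0" using uv uv' \<open>x \<noteq> y\<close> by (auto simp: a_def)
  have row: "z * (\<Sum>k<n. a i k) + y * (real n - 1) = 0" if "i < n" for i
    using sum_combination[of i "\<lambda>i j. S $$ (i, j)" z y] s sol that by simp
  define r where "r = card {k. k < n \<and> a u k = 1}"
  have zr: "z * real r + y * (real n - 1) = 0" using row[of u] uv by (simp add: r_def sum_eq_card)
  have deg: "(\<Sum>k<n. a i k) = real r" if "i < n" for i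
    using row[OF that] zr z by (metis add_right_cancel mult_left_cancel)
  define l m where "l = card {k. k < n \<and> a u k = 1 \<and> a v k = 1}"
    and "m = card {k. k < n \<and> a u' k = 1 \<and> a v' k = 1}"
  have sq: "z\<^sup>2 * (\<Sum>k<n. a i k * a k j) =
      \<theta> * (z * a i j + y) - (z * a i j + y)\<^sup>2 - 2 * z * y * (real r - a i j) - y\<^sup>2 * (real n - 2)"
    if ij: "i < n" "j < n" "i \<noteq> j" for i j
  proof -
    have "(\<Sum>k<n. S $$ (i, k) * S $$ (k, j)) =
      z\<^sup>2 * (\<Sum>k<n. a i k * a k j) + 2 * z * y * (real r - a i j) + y\<^sup>2 * (real n - 2)"
      by (rule combination_square[where s = "\<lambda>i j. S $$ (i, j)"]) (use deg s ij in auto)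
    moreover have "(S $$ (i, j))\<^sup>2 + (\<Sum>k<n. S $$ (i, k) * S $$ (k, j)) = \<theta> * S $$ (i, j)"
      using sol ij by blast
    ultimately show ?thesis using s[of i j] ij by simp
  qed
  have L: "(\<Sum>k<n. a u k * a k v) = real l" "(\<Sum>k<n. a u' k * a k v') = real m"
    using uv uv' by (simp_all add: square_eq_card l_def m_def)
  have eq: "(\<Sum>k<n. a i k * a k j) = (\<Sum>k<n. a i' k * a k j')"
    if "i < n" "j < n" "i \<noteq> j" "i' < n" "j' < n" "i' \<noteq> j'" "a i j = a i' j'" for i j i' j'
  proof -
    have "z\<^sup>2 * (\<Sum>k<n. a i k * a k j) = z\<^sup>2 * (\<Sum>k<n. a i' k * a k j')"
      using that by (simp add: sq)
    then show ?thesis using z by simp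
  qed
  have "srg_matrix n a r l m"
  proof
    show "(\<Sum>k<n. a i k * a k j) = real l" if "i < n" "j < n" "a i j = 1" for i j
      using eq[of i j u v] that uv auv L by (cases "i = j") (auto simp: diag)
    show "(\<Sum>k<n. a i k * a k j) = real m" if "i < n" "j < n" "i \<noteq> j" "a i j = 0" for i j
      using eq[of i j u' v'] that uv' auv L by auto
    show "0 < r" using uv auv by (auto simp: r_def card_gt_0_iff)
    \<comment> \<open>The neighbors of \<open>u'\<close> avoid both \<open>u'\<close> and its
      non-neighbor \<open>v'\<close>, so the degree is at most \<open>n - 2\<close>.\<close>
    have "{k. k < n \<and> a u' k = 1} \<subseteq> {..<n} - {u', v'}" using auv uv' diag by auto
    then have "card {k. k < n \<and> a u' k = 1} \<le> card ({..<n} - {u', v'})" by (intro card_mono) auto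
    also have "\<dots> = n - 2" using uv' by (simp add: card_Diff_subset)
    finally show "r < n - 1" using deg[of u'] sum_eq_card[of u'] uv' by auto
  qed (use deg in auto)
  moreover have "\<theta> = z * (real l - real m + 1)"
  proof -
    \<comment> \<open>The difference of the equations at the reference edge and non-edge; dividing
      by the square of \<open>z\<close> determines \<open>\<theta> / z\<close>.\<close>
    have "z\<^sup>2 * real l - z\<^sup>2 * real m = \<theta> * z - (z + y)\<^sup>2 + y\<^sup>2 + 2 * z * y"
      using sq[of u v] sq[of u' v'] uv uv' auv L by (simp add: algebra_simps)
    then have "z * \<theta> = z * (z * (real l - real m + 1))"
      by (simp add: algebra_simps power2_eq_square)
    then show ?thesis using z by simp
  qed
  ultimately show ?thesis using that zr by (simp add: z_def algebra_simps)
qed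

text \<open>Exchanging \<open>x\<close> and \<open>y\<close> passes to the complementary graph. The
  two degrees add up to \<open>n - 1\<close>, so one of them is below \<open>n / 2\<close> and its
  graph has conference parameters; \<open>m = l + 1\<close> then gives
  \<open>\<theta> = 0\<close>.\<close>

lemma solves_two_valued_prime:
  assumes "prime n" "n \<ge> 4" "solves n S \<theta>" "two_valued S x y"
  shows "[n = 1] (mod 4) \<and> \<theta> = 0"
proof -
  obtain r l m where srg: "srg_matrix n (\<lambda>i j. of_bool (i \<noteq> j \<and> S $$ (i, j) = x)) r l m"
    and r: "real r * (x - y) + (real n - 1) * y = 0" and th: "\<theta> = (x - y) * (real l - real m + 1)"
    using solves_two_valued_imp_srg_matrix[OF assms(3,4)] by blast
  obtain r' l' m' where srg': "srg_matrix n (\<lambda>i j. of_bool (i \<noteq> j \<and> S $$ (i, j) = y)) r' l' m'"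
    and r': "real r' * (y - x) + (real n - 1) * x = 0" and th': "\<theta> = (y - x) * (real l' - real m' + 1)"
    using solves_two_valued_imp_srg_matrix[OF assms(3) assms(4)[unfolded two_valued_commute[of S x y]]]
    by blast
  have "x \<noteq> y" using assms(4) by (simp add: two_valued_def)
  have "(x - y) * (real r + real r' - (real n - 1)) = 0" using r r' by (simp add: algebra_simps)
  then have "r + r' + 1 = n" using \<open>x \<noteq> y\<close> by auto
  moreover have "odd n" using assms(1,2) by (auto simp: prime_odd_nat)
  ultimately consider "2 * r < n" | "2 * r' < n" by linarith
  then show ?thesis
  proof cases
    case 1
    then show ?thesis
      using srg_matrix.prime_imp_conference[OF srg assms(1)] th by (auto simp: cong_def)
  next
    case 2
    then show ?thesis
      using srg_matrix.prime_imp_conference[OF srg' assms(1)] th' by (auto simp: cong_def)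
  qed
qed

section \<open>Strongly regular graphs and their solutions\<close>

lemma off_diagonal_entriesI:
  "i < dim_row S \<Longrightarrow> j < dim_col S \<Longrightarrow> i \<noteq> j \<Longrightarrow> S $$ (i, j) \<in> off_diagonal_entries S"
  by (auto simp: off_diagonal_entries_def)

text \<open>Row sums and entries of the square count neighbors and common neighbors. The bounds on
  \<open>r\<close> come from an edge, as A is not 0, and a non-edge, as A is not K.\<close>

lemma srg_imp_srg_matrix:
  assumes adj: "is_adjacency_mat n G A" and srg: "srg G n r l m"
    and A: "A \<noteq> 0\<^sub>m n n" "A \<noteq> complete_mat n"
  shows "srg_matrix n (\<lambda>i j. A $$ (i, j)) r l m"
proof -
  have G: "pair_graph G" using srg by (simp add: srg_def)
  then interpret G: pair_graph G .
  have V: "pverts G = {0..<n}" and A_eq: "A = mat n n (\<lambda>(u, v). if (u, v) \<in> parcs G then 1 else 0)"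
    using adj by (simp_all add: is_adjacency_mat_def)
  have a: "A $$ (i, j) = (if (i, j) \<in> parcs G then 1 else 0)" if "i < n" "j < n" for i j
    using that by (simp add: A_eq)
  have loopfree: "(i, i) \<notin> parcs G" for i using G.no_loops' by blast
  have symG: "(i, j) \<in> parcs G \<longleftrightarrow> (j, i) \<in> parcs G" for i j using G.arcs_symmetric by blast
  have nb: "{k. k < n \<and> A $$ (i, k) = 1} = neighbors G i" if "i < n" for i
    using that by (auto simp: neighbors_def V a split: if_splits)
  have nb2: "{k. k < n \<and> A $$ (i, k) = 1 \<and> A $$ (j, k) = 1} = neighbors G i \<inter> neighbors G j"
    if "i < n" "j < n" for i j
    using nb[OF that(1)] nb[OF that(2)] by blast
  interpret symmetric_01 n "\<lambda>i j. A $$ (i, j)"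
  proof
    show "A $$ (i, j) = A $$ (j, i)" if "i < n" "j < n" for i j
      using that symG[of i j] by (simp add: a)
  qed (auto simp: a loopfree)
  show ?thesis
  proof
    show deg: "(\<Sum>k<n. A $$ (i, k)) = real r" if "i < n" for i
      using srg that by (simp add: sum_eq_card nb srg_def V)
    show "(\<Sum>k<n. A $$ (i, k) * A $$ (k, j)) = real l" if "i < n" "j < n" "A $$ (i, j) = 1" for i j
      using srg that a[of i j] by (simp add: square_eq_card nb2 srg_def V split: if_splits)
    show "(\<Sum>k<n. A $$ (i, k) * A $$ (k, j)) = real m" if "i < n" "j < n" "i \<noteq> j" "A $$ (i, j) = 0" for i j
      using srg that a[of i j] by (simp add: square_eq_card nb2 srg_def V split: if_splits)
    have deg_card: "card {k. k < n \<and> A $$ (i, k) = 1} = r" if "i < n" for i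
      using deg[OF that] sum_eq_card[OF that] by simp
    show "0 < r"
    proof -
      have "\<exists>i j. i < n \<and> j < n \<and> A $$ (i, j) = 1"
        using A(1) by (fastforce simp: A_eq mat_eq_iff)
      then obtain i j where "i < n" "j < n" "A $$ (i, j) = 1" by blast
      then have "card {k. k < n \<and> A $$ (i, k) = 1} > 0" by (auto simp: card_gt_0_iff)
      then show ?thesis using deg_card \<open>i < n\<close> by simp
    qed
    show "r < n - 1"
    proof -
      have "\<exists>i j. i < n \<and> j < n \<and> i \<noteq> j \<and> A $$ (i, j) = 0"
      proof (rule ccontr)
        assume "\<not> ?thesis"
        then have off: "i = j \<or> A $$ (i, j) \<noteq> 0" if "i < n" "j < n" for i j
          using that by blast
        have "A = complete_mat n"
        proof (rule eq_matI)
          fix i j assume "i < dim_row (complete_mat n)" "j < dim_col (complete_mat n)"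
          then have "i < n" "j < n" by (simp_all add: complete_mat_def)
          then show "A $$ (i, j) = complete_mat n $$ (i, j)"
            using off[of i j] diag[of i] zero_one[of i j]
            by (auto simp: complete_mat_def all_one_mat_def)
        qed (simp_all add: A_eq complete_mat_def)
        then show False using A(2) by simp
      qed
      then obtain i j where ij: "i < n" "j < n" "i \<noteq> j" "A $$ (i, j) = 0" by blast
      then have "{k. k < n \<and> A $$ (i, k) = 1} \<subseteq> {..<n} - {i, j}" using diag by auto
      then have "card {k. k < n \<and> A $$ (i, k) = 1} \<le> card ({..<n} - {i, j})"
        by (intro card_mono) auto
      also have "\<dots> = n - 2" using ij by (simp add: card_Diff_subset)
      finally show ?thesis using deg_card[of i] ij by auto
    qed
  qed
qed

lemma (in srg_matrix) obtain_srg: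
  obtains G where "is_adjacency_mat n G (mat n n (\<lambda>(i, j). a i j))" "srg G n r l m"
proof -
  define G :: "nat pair_pre_digraph"
    where "G = \<lparr>pverts = {0..<n}, parcs = {(i, j). i < n \<and> j < n \<and> a i j = 1}\<rparr>"
  have [simp]: "pverts G = {0..<n}" "(i, j) \<in> parcs G \<longleftrightarrow> i < n \<and> j < n \<and> a i j = 1" for i j
    by (simp_all add: G_def)
  have "pair_graph G"
  proof
    show "finite (parcs G)"
      by (rule finite_subset[of _ "{0..<n} \<times> {0..<n}"]) auto
    show "symmetric (with_proj G)"
      using sym by (auto simp: symmetric_def intro!: symI)
  qed (use diag in auto)
  have nb: "neighbors G i = {k. k < n \<and> a i k = 1}" if "i < n" for i
    using that by (auto simp: neighbors_def)
  have nb2: "neighbors G i \<inter> neighbors G j = {k. k < n \<and> a i k = 1 \<and> a j k = 1}"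
    if "i < n" "j < n" for i j
    using that by (auto simp: nb)
  have "srg G n r l m"
    unfolding srg_def
  proof (intro conjI ballI impI)
    fix u assume u: "u \<in> pverts G"
    then show "card (neighbors G u) = r"
      using degree[of u] by (simp add: sum_eq_card nb)
    fix v assume v: "v \<in> pverts G"
    show "card (neighbors G u \<inter> neighbors G v) = l" if "(u, v) \<in> parcs G"
      using adjacent[of u v] that by (simp add: square_eq_card nb2)
    show "card (neighbors G u \<inter> neighbors G v) = m" if "u \<noteq> v \<and> (u, v) \<notin> parcs G"
      using non_adjacent[of u v] zero_one[of u v] that u v by (simp add: square_eq_card nb2)
  qed (use \<open>pair_graph G\<close> in simp_all)
  moreover have "is_adjacency_mat n G (mat n n (\<lambda>(i, j). a i j))"
    unfolding is_adjacency_mat_def by (auto intro!: cong_mat dest: zero_one)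
  ultimately show ?thesis using that by blast
qed

lemma (in srg_matrix) two_valued_combination:
  assumes S: "S \<in> carrier_mat n n"
    and s: "\<And>i j. i < n \<Longrightarrow> j < n \<Longrightarrow> S $$ (i, j) = z * a i j + y * of_bool (i \<noteq> j)"
    and "z \<noteq> 0"
  shows "two_valued S (z + y) y"
proof -
  obtain j where j: "j < n" "a 0 j = 1" using obtain_adjacent by blast
  then have "j \<noteq> 0" using diag[OF n_pos] by (metis zero_neq_one)
  then have "S $$ (0, j) = z + y" using s[OF n_pos] j by simp
  moreover obtain k where k: "k < n" "k \<noteq> 0" "a 0 k = 0" using obtain_non_adjacent by blast
  then have "S $$ (0, k) = y" using s[OF n_pos] by simp
  ultimately have "{z + y, y} \<subseteq> off_diagonal_entries S"
    using n_pos j k \<open>j \<noteq> 0\<close> S off_diagonal_entriesI[of 0 S j] off_diagonal_entriesI[of 0 S k] by auto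
  moreover have "off_diagonal_entries S \<subseteq> {z + y, y}"
  proof
    fix x assume "x \<in> off_diagonal_entries S"
    then obtain i j where "i < n" "j < n" "i \<noteq> j" "x = S $$ (i, j)"
      using S by (auto simp: off_diagonal_entries_def)
    then show "x \<in> {z + y, y}" using s[of i j] zero_one[of i j] by auto
  qed
  ultimately show ?thesis using \<open>z \<noteq> 0\<close> by (auto simp: two_valued_def)
qed

text \<open>There are \<open>c\<close> cliques, each a block of \<open>b\<close> consecutive numbers
  with the same quotient by \<open>b\<close>. Adjacent vertices share the rest of their block, and
  vertices of different blocks share no neighbor.\<close>

lemma srg_matrix_disjoint_cliques:
  assumes "1 < b" "1 < c"
  shows "srg_matrix (c * b) (\<lambda>i j. of_bool (i \<noteq> j \<and> i div b = j div b)) (b - 1) (b - 2) 0"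
proof -
  define n where "n = c * b"
  define a where "a = (\<lambda>i j. of_bool (i \<noteq> j \<and> i div b = j div b) :: real)"
  interpret symmetric_01 n a by unfold_locales (auto simp: a_def)
  \<comment> \<open>As \<open>n\<close> is a multiple of \<open>b\<close>, the last block is not cut
    off at \<open>n\<close>.\<close>
  have block: "{k. k < n \<and> k div b = i div b} = {i div b * b..<i div b * b + b}" if "i < n" for i
  proof -
    have "i div b < c" using that by (simp add: n_def less_mult_imp_div_less)
    then have le: "i div b * b + b \<le> n" unfolding n_def
      by (metis Suc_leI add.commute mult_Suc mult_le_mono1)
    have iff: "k div b = i div b \<longleftrightarrow> i div b * b \<le> k \<and> k < i div b * b + b" for k
    proof -
      have "k div b = i div b \<longleftrightarrow> i div b \<le> k div b \<and> k div b < Suc (i div b)" by linarith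
      also have "\<dots> \<longleftrightarrow> i div b * b \<le> k \<and> k < Suc (i div b) * b"
        using assms(1) by (simp add: less_eq_div_iff_mult_less_eq div_less_iff_less_mult del: mult_Suc)
      finally show ?thesis by (simp add: add.commute)
    qed
    show ?thesis unfolding iff using le by auto
  qed
  have card_block: "card {k. k < n \<and> k div b = i div b} = b" if "i < n" for i
    by (simp add: block[OF that])
  have "srg_matrix n a (b - 1) (b - 2) 0"
  proof
    show "(\<Sum>k<n. a i k) = real (b - 1)" if "i < n" for i
    proof -
      have "{k. k < n \<and> a i k = 1} = {k. k < n \<and> k div b = i div b} - {i}"
        by (auto simp: a_def)
      then show ?thesis using that by (simp add: sum_eq_card card_block)
    qed
    show "(\<Sum>k<n. a i k * a k j) = real (b - 2)" if "i < n" "j < n" "a i j = 1" for i j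
    proof -
      have ij: "i \<noteq> j" "i div b = j div b" using that by (auto simp: a_def split: if_splits)
      then have "{k. k < n \<and> a i k = 1 \<and> a j k = 1} = {k. k < n \<and> k div b = i div b} - {i, j}"
        by (auto simp: a_def)
      moreover have "card ({k. k < n \<and> k div b = i div b} - {i, j}) = b - 2"
        using that ij by (subst card_Diff_subset) (auto simp: card_block)
      ultimately show ?thesis using that by (simp add: square_eq_card)
    qed
    show "(\<Sum>k<n. a i k * a k j) = real 0" if "i < n" "j < n" "i \<noteq> j" "a i j = 0" for i j
      using that by (auto simp: a_def intro!: sum.neutral)
    show "0 < b - 1" using assms by simp
    have "2 * b \<le> n" using assms by (simp add: n_def)
    then show "b - 1 < n - 1" using assms by linarith
  qed
  then show ?thesis by (simp add: n_def a_def)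
qed

section \<open>Paley graphs of prime order\<close>

lemma sum_int_lessThan: "(\<Sum>k<n. f (int k)) = (\<Sum>w\<in>{0..<int n}. f w)"
  using sum.reindex[of int "{0..<n}" f]
  by (simp add: image_int_atLeastLessThan lessThan_atLeast0)

text \<open>The Paley graph with 1 on edges and -1 on non-edges. Symmetry holds because -1 is a
  square modulo \<open>p\<close>; off the diagonal the shifted character sum -1 cancels the squared
  entry 1.\<close>

lemma Paley_solves:
  fixes p :: nat
  assumes p: "prime p" "2 < p" "[p = 1] (mod 4)"
  defines "S \<equiv> mat p p (\<lambda>(i, j). real_of_int (Legendre (int i - int j) (int p)))"
  shows "solves p S 0" "two_valued S 1 (- 1)"
proof -
  have S: "S \<in> carrier_mat p p" by (simp add: S_def)
  have s: "S $$ (i, j) = of_int (Legendre (int i - int j) (int p))" if "i < p" "j < p" for i j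
    using that by (simp add: S_def)
  have even: "Legendre (x - y) (int p) = Legendre (y - x) p" for x y
    using Legendre_mult[OF p(1,2), of "- 1" "y - x"] Legendre_minus_1[OF p] by simp
  have nd: "\<not> int p dvd int i - int j" if "i < p" "j < p" "i \<noteq> j" for i j
    using that by (auto simp flip: cong_iff_dvd_diff dest: cong_less_modulus_unique_nat
        simp: cong_int_iff)
  have "(\<Sum>j<p. S $$ (i, j)) = 0" if "i < p" for i
  proof -
    have "(\<Sum>j<p. S $$ (i, j)) = of_int (\<Sum>w<p. Legendre (1 * int w + - int i) p)"
      using that by (simp add: s even[of "int i"])
    also have "(\<Sum>w<p. Legendre (1 * int w + - int i) p) = (\<Sum>w\<in>{0..<int p}. Legendre w p)"
      unfolding sum_int_lessThan[of "\<lambda>w. Legendre (1 * w + - int i) p"]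
      using p by (intro sum_affine_mod) auto
    finally show ?thesis using sum_Legendre[OF p(1,2)] by simp
  qed
  moreover have "(S $$ (i, j))\<^sup>2 + (\<Sum>k<p. S $$ (i, k) * S $$ (k, j)) = 0"
    if ij: "i < p" "j < p" "i \<noteq> j" for i j
  proof -
    \<comment> \<open>With \<open>w = k - i\<close>, the second factor has argument
      \<open>k - j = w + (i - j)\<close>; evenness turns \<open>i - k\<close> into
      \<open>k - i\<close> in the first.\<close>
    define g where "g w = Legendre w p * Legendre (w + (int i - int j)) p" for w
    have "(\<Sum>k<p. S $$ (i, k) * S $$ (k, j)) = of_int (\<Sum>k<p. g (1 * int k + - int i))"
      using ij by (simp add: s even[of "int i"] g_def)
    also have "(\<Sum>k<p. g (1 * int k + - int i)) = (\<Sum>w\<in>{0..<int p}. g w)"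
      unfolding sum_int_lessThan[of "\<lambda>w. g (1 * w + - int i)"]
    proof (intro sum_affine_mod)
      show "g (w mod int p) = g w" for w
        unfolding g_def by (metis Legendre_mod mod_add_left_eq)
    qed (use p in auto)
    also have "\<dots> = - 1"
      unfolding g_def by (rule sum_Legendre_shift[OF p(1,2) nd[OF ij]])
    finally have "(\<Sum>k<p. S $$ (i, k) * S $$ (k, j)) = - 1" by simp
    moreover have "(S $$ (i, j))\<^sup>2 = 1"
      using ij Legendre_square[OF p(1,2) nd[OF ij]] by (simp add: s power2_eq_square flip: of_int_mult)
    ultimately show ?thesis by simp
  qed
  ultimately show "solves p S 0"
    using even by (simp add: solves_iff[OF S] s Legendre_eq_0_iff)
  \<comment> \<open>Both values appear in column 0: at a non-residue and at row 1.\<close>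
  obtain g where "Legendre g (int p) = - 1" using exists_Legendre_minus_1[OF p(1,2)] by blast
  then have g: "Legendre (g mod int p) (int p) = - 1" by simp
  define i where "i = nat (g mod int p)"
  have i: "int i = g mod int p" "i < p" using p by (simp_all add: i_def nat_less_iff)
  have "g mod int p \<noteq> 0" using g Legendre_eq_0_iff[of g p] by auto
  then have "i \<noteq> 0" using i by auto
  have 1: "Legendre 1 (int p) = 1" using Legendre_mult[OF p(1,2), of 1 1] Legendre_eq_0_iff[of 1 p] p
    by auto
  have "S $$ (i, 0) = - 1" "S $$ (1, 0) = 1" using i g p 1 by (simp_all add: s)
  then have "{1, - 1} \<subseteq> off_diagonal_entries S"
    using i \<open>i \<noteq> 0\<close> p S off_diagonal_entriesI[of i S 0] off_diagonal_entriesI[of 1 S 0] by auto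
  moreover have "off_diagonal_entries S \<subseteq> {1, - 1}"
  proof
    fix x assume "x \<in> off_diagonal_entries S"
    then obtain i j where ij: "i < p" "j < p" "i \<noteq> j" "x = S $$ (i, j)"
      using S by (auto simp: off_diagonal_entries_def)
    then show "x \<in> {1, - 1}"
      using Legendre_values[of "int i - int j" p] Legendre_eq_0_iff[of "int i - int j" p] nd[of i j]
      by (auto simp: s)
  qed
  ultimately show "two_valued S 1 (- 1)" by (auto simp: two_valued_def)
qed

section \<open>Translation between solutions and graphs\<close>

lemma combination_entry:
  assumes "i < n" "j < n" "A \<in> carrier_mat n n"
  shows "(z \<cdot>\<^sub>m A + y \<cdot>\<^sub>m complete_mat n) $$ (i, j) = z * A $$ (i, j) + y * of_bool (i \<noteq> j)"
  using assms by (auto simp: complete_mat_def all_one_mat_def)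

lemma solution_imp_srg:
  assumes sol: "solves n S \<theta>" and two: "two_valued S x y"
  shows "\<exists>A G r l m. S = (x - y) \<cdot>\<^sub>m A + y \<cdot>\<^sub>m complete_mat n \<and>
    A \<noteq> 0\<^sub>m n n \<and> A \<noteq> complete_mat n \<and> is_adjacency_mat n G A \<and> srg G n r l m"
proof -
  define a where "a = (\<lambda>i j. of_bool (i \<noteq> j \<and> S $$ (i, j) = x) :: real)"
  obtain r l m where "srg_matrix n (\<lambda>i j. of_bool (i \<noteq> j \<and> S $$ (i, j) = x)) r l m"
      "real r * (x - y) + (real n - 1) * y = 0" "\<theta> = (x - y) * (real l - real m + 1)"
    using solves_two_valued_imp_srg_matrix[OF assms] by blast
  from this(1) interpret srg_matrix n a r l m unfolding a_def .
  define A where "A = mat n n (\<lambda>(i, j). a i j)"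
  obtain G where G: "is_adjacency_mat n G A" "srg G n r l m"
    using obtain_srg[folded A_def] by blast
  have S: "S \<in> carrier_mat n n" using sol by (simp add: solves_def)
  have A: "A \<in> carrier_mat n n" by (simp add: A_def)
  have "S = (x - y) \<cdot>\<^sub>m A + y \<cdot>\<^sub>m complete_mat n"
  proof (rule eq_matI)
    fix i j
    assume "i < dim_row ((x - y) \<cdot>\<^sub>m A + y \<cdot>\<^sub>m complete_mat n)"
      "j < dim_col ((x - y) \<cdot>\<^sub>m A + y \<cdot>\<^sub>m complete_mat n)"
    then have ij: "i < n" "j < n" by (simp_all add: complete_mat_def)
    have "S $$ (i, j) = (x - y) * a i j + y * of_bool (i \<noteq> j)"
      using two_valued_eq[OF two, of i j] sol ij S by (auto simp: a_def solves_iff[OF S])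
    then show "S $$ (i, j) = ((x - y) \<cdot>\<^sub>m A + y \<cdot>\<^sub>m complete_mat n) $$ (i, j)"
      using ij by (simp add: combination_entry[OF ij A]) (simp add: A_def)
  qed (use S in \<open>simp_all add: complete_mat_def\<close>)
  moreover have "A \<noteq> 0\<^sub>m n n"
  proof
    assume *: "A = 0\<^sub>m n n"
    obtain j where "j < n" "a 0 j = 1" using obtain_adjacent by blast
    moreover have "A $$ (0, j) = a 0 j" using calculation n_pos by (simp add: A_def)
    ultimately show False using * n_pos by simp
  qed
  moreover have "A \<noteq> complete_mat n"
  proof
    assume *: "A = complete_mat n"
    obtain j where "j < n" "j \<noteq> 0" "a 0 j = 0" using obtain_non_adjacent by blast
    moreover have "A $$ (0, j) = a 0 j" using calculation n_pos by (simp add: A_def)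
    ultimately show False using * n_pos by (simp add: complete_mat_def all_one_mat_def)
  qed
  ultimately show ?thesis using G by blast
qed

lemma srg_imp_solution:
  assumes adj: "is_adjacency_mat n G A" and srg: "srg G n r l m"
    and A: "A \<noteq> 0\<^sub>m n n" "A \<noteq> complete_mat n"
    and z: "z \<noteq> 0" and yz: "y / z = real r / (1 - real n)"
  defines "S \<equiv> z \<cdot>\<^sub>m A + y \<cdot>\<^sub>m complete_mat n"
  shows "\<exists>\<theta>. solves n S \<theta> \<and> theta_hat S \<theta> =
    \<bar>real l - real m + 1\<bar> * sqrt ((real n - 1) / (real n * real r * (real n - real r - 1)))"
proof -
  interpret srg_matrix n "\<lambda>i j. A $$ (i, j)" r l m
    using srg_imp_srg_matrix[OF adj srg A] .
  have Ac: "A \<in> carrier_mat n n" using adj by (simp add: is_adjacency_mat_def)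
  have S: "S \<in> carrier_mat n n" using Ac by (auto simp: S_def complete_mat_def all_one_mat_def)
  have s: "S $$ (i, j) = z * A $$ (i, j) + y * of_bool (i \<noteq> j)" if "i < n" "j < n" for i j
    unfolding S_def using that Ac by (rule combination_entry)
  have n1: "real n - 1 > 0" using r_less by simp
  \<comment> \<open>The prescribed ratio of \<open>y\<close> and \<open>z\<close> says exactly that
    the row sums of \<open>S\<close> vanish.\<close>
  have zy: "real r * z + (real n - 1) * y = 0"
    using yz z n1 by (simp add: field_simps)
  \<comment> \<open>The factor \<open>\<bar>z\<bar>\<close> of the norm cancels against that of
    \<open>\<theta>\<close>.\<close>
  have "theta_hat S (z * (real l - real m + 1)) =
    \<bar>real l - real m + 1\<bar> * sqrt ((real n - 1) / (real n * real r * (real n - real r - 1)))"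
    using z by (simp add: theta_hat_def norm2_combination[OF S s zy] abs_mult real_sqrt_divide)
  then show ?thesis using solves_combination[OF S s zy] by blast
qed

lemma composite_imp_solution:
  assumes "composite n"
  shows "\<exists>S \<theta> x y. solves n S \<theta> \<and> two_valued S x y"
proof -
  obtain b c where bc: "1 < b" "1 < c" "n = c * b" using assms by (auto simp: composite_def)
  define a where "a = (\<lambda>i j. of_bool (i \<noteq> j \<and> i div b = j div b) :: real)"
  interpret srg_matrix n a "b - 1" "b - 2" 0
    using srg_matrix_disjoint_cliques[OF bc(1,2)] unfolding bc(3) a_def .
  \<comment> \<open>Chosen to make the row sums 0 for \<open>z = 1\<close>; the factor 1 in
    \<open>S\<close> keeps the shape \<open>z * a i j\<close> of the general results.\<close>
  define y where "y = - real (b - 1) / (real n - 1)"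
  define S where "S = mat n n (\<lambda>(i, j). 1 * a i j + y * of_bool (i \<noteq> j))"
  have S: "S \<in> carrier_mat n n"
    and s: "\<And>i j. i < n \<Longrightarrow> j < n \<Longrightarrow> S $$ (i, j) = 1 * a i j + y * of_bool (i \<noteq> j)"
    by (simp_all add: S_def)
  have "real n - 1 \<noteq> 0" using r_less by simp
  then have zy: "real (b - 1) * 1 + (real n - 1) * y = 0" by (simp add: y_def)
  show ?thesis
    using solves_combination[OF S s zy] two_valued_combination[OF S s] by (metis zero_neq_one)
qed

theorem theorem5p1:
  fixes n :: nat
  assumes "n \<ge> 4"
  shows
    "(\<forall>S \<theta> x y z. solves n S \<theta> \<and> two_valued S x y \<and> z = x - y \<longrightarrow>
        (\<exists>A G r l m. S = z \<cdot>\<^sub>m A + y \<cdot>\<^sub>m complete_mat n \<and>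
           A \<noteq> 0\<^sub>m n n \<and> A \<noteq> complete_mat n \<and>
           is_adjacency_mat n G A \<and> srg G n r l m))
     \<and>
     (\<forall>A G r l m y z.
        is_adjacency_mat n G A \<and> srg G n r l m \<and>
        A \<noteq> 0\<^sub>m n n \<and> A \<noteq> complete_mat n \<and>
        z \<noteq> 0 \<and> y / z = real r / (1 - real n) \<longrightarrow>
        (let S = z \<cdot>\<^sub>m A + y \<cdot>\<^sub>m complete_mat n; r\<^sub>c = real n - real r - 1 in
           \<exists>\<theta>. solves n S \<theta> \<and>
             theta_hat S \<theta> =
               \<bar>real l - real m + 1\<bar> * sqrt ((real n - 1) / (real n * real r * r\<^sub>c))))
     \<and>
     ((\<exists>S \<theta> x y. solves n S \<theta> \<and> two_valued S x y) \<longleftrightarrow>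
        composite n \<or> (prime n \<and> [n = 1] (mod 4)))
     \<and>
     (prime n \<and> [n = 1] (mod 4) \<longrightarrow>
        (\<forall>S \<theta> x y. solves n S \<theta> \<and> two_valued S x y \<longrightarrow> \<theta> = 0))"
proof (intro conjI)
  have "composite n" if "\<not> prime n"
  proof -
    obtain d where d: "d dvd n" "d \<noteq> 1" "d \<noteq> n"
      using \<open>\<not> prime n\<close> assms by (auto simp: prime_nat_iff)
    then obtain c where "n = d * c" by blast
    moreover have "1 < d" "1 < c" using d calculation assms by (auto intro!: Suc_lessI gr0I)
    ultimately show ?thesis by (auto simp: composite_def)
  qed
  moreover have "[n = 1] (mod 4)" if "prime n" "solves n S \<theta>" "two_valued S x y" for S \<theta> x y
    using solves_two_valued_prime that assms by blast
  moreover have "\<exists>S \<theta> x y. solves n S \<theta> \<and> two_valued S x y" if "prime n" "[n = 1] (mod 4)"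
  proof -
    have "2 < n" using assms by simp
    from Paley_solves[OF that(1) this that(2)] show ?thesis by blast
  qed
  ultimately show "(\<exists>S \<theta> x y. solves n S \<theta> \<and> two_valued S x y) \<longleftrightarrow>
      composite n \<or> (prime n \<and> [n = 1] (mod 4))"
    using composite_imp_solution by blast
  show "prime n \<and> [n = 1] (mod 4) \<longrightarrow>
      (\<forall>S \<theta> x y. solves n S \<theta> \<and> two_valued S x y \<longrightarrow> \<theta> = 0)"
    using solves_two_valued_prime assms by blast
next
  show "\<forall>S \<theta> x y z. solves n S \<theta> \<and> two_valued S x y \<and> z = x - y \<longrightarrow>
      (\<exists>A G r l m. S = z \<cdot>\<^sub>m A + y \<cdot>\<^sub>m complete_mat n \<and>
         A \<noteq> 0\<^sub>m n n \<and> A \<noteq> complete_mat n \<and>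
         is_adjacency_mat n G A \<and> srg G n r l m)"
    (is "\<forall>S \<theta> x y z. _ \<longrightarrow> ?P S y z")
  proof (intro allI impI)
    fix S \<theta> x y z
    assume "solves n S \<theta> \<and> two_valued S x y \<and> z = x - y"
    then have "solves n S \<theta>" "two_valued S x y" "z = x - y" by simp_all
    from solution_imp_srg[OF this(1,2)] show "?P S y z" unfolding \<open>z = x - y\<close> .
  qed
\<comment> \<open>The goal left is the passage from strongly regular graphs to solutions.\<close>
qed (unfold Let_def, intro allI impI, elim conjE, rule srg_imp_solution)

end
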